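(* Let $K_1,K_2,\dots$ be a sequence of knots (or links) in which $K_{i+1}$ is obtained from $K_1$ by adding $i$ full twists in a twist region $\tau$ whose two strands are anti-parallel, and let $L_\infty$ be the link obtained by resolving $\tau$. Let $r\ge1$ and let $P_r(K_\infty)=\lim_{i\to\infty}P_r(K_i)$ be the stable limit of the reduced $Sym^r$-coloured HOMFLY-PT polynomials. Then $$P_r(K_\infty)=\frac{P^{\mathrm{fin}}_r(L_\infty)}{(a^2;q^2)_r}\simeq\frac{P_r(L_\infty)}{\overline P_r(0_1)},$$ where $\simeq$ denotes equality up to sign and a monomial factor in $a,q$.
   Context: $P_r(L)=P_r(L;a,q)$ denotes the reduced $Sym^r$-coloured HOMFLY-PT invariant (every component coloured by $Sym^r$), normalised by $P_r(\bigcirc)=1$; for $r=1$ it satisfies $aP_1(L_{\text{over}})-a^{-1}P_1(L_{\text{under}})=(q-q^{-1})P_1(L_0)$, and the left-handed trefoil has $P_1=a^2q^{-2}+a^2q^2-a^4$. $\overline P_r(0_1)$ is the unreduced $Sym^r$-coloured invariant of the unknot, equal up to a monomial factor to $(a^2;q^2)_r/(q^2;q^2)_r$, where $(\xi;q^2)_r=\prod_{j=0}^{r-1}(1-\xi q^{2j})$. A twist region of a link diagram is a maximal collection of bigon regions arranged end to end. A full twist added in $\tau$ twists the pair of strands twice (adds two crossings). $K_0$ denotes the knot obtained from $K_1$ by removing a full twist in $\tau$. $L_\infty$ is obtained by performing, at a crossing of $\tau$, the orientation-compatible smoothing (for anti-parallel strands this undoes the whole twist region, and gives a two-component link if the $K_i$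 are knots). $P_r^{\mathrm{fin}}(L_\infty)$ is the finite (polynomial) version of the reduced invariant of $L_\infty$: up to sign and a monomial it equals $(q^2;q^2)_r\,P_r(L_\infty)$, and its monomial normalisation is the one for which the following known twist recursion for anti-parallel strands (which may be taken as given) holds: for all $j\ge0$, $$\sum_{i=0}^{r}(-1)^i\epsilon_i(\lambda_1,\dots,\lambda_r)\,P_r(K_{j+r-i})=[2]_{aq}[3]_{aq^2}\cdots[r]_{aq^{r-1}}\,P_r^{\mathrm{fin}}(L_\infty),$$ with $\lambda_\ell=a^{2\ell}q^{2\ell(\ell-1)}$, $\epsilon_i$ the $i$-th elementary symmetric polynomial, and $[m]_y=\frac{1-y^{2m}}{1-y^2}$. (The handedness of the added full twists is the one for which this recursion holds.) The limit is taken in formal Laurent series in $a$ (with coefficients in $\mathbb{Q}(q)$), where it exists; the asserted identity is one of rational functions in $a,q$. *)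

theory Defs
  imports
    "HOL-Computational_Algebra.Formal_Laurent_Series"
    "HOL-Computational_Algebra.Fraction_Field"
    "HOL-Computational_Algebra.Polynomial"
begin

section \<open>The coefficient field\<close>

text \<open>
  All invariants take values in \<open>\<rat>(q)((a))\<close>, formal Laurent series in \<open>a\<close> over \<open>\<rat>(q)\<close>.  It contains
  the rational functions in \<open>a, q\<close>; the library metric on it is the \<open>a\<close>-adic one.
\<close>

type_synonym laurent = "rat poly fract fls"

definition va :: laurent where
  "va = fls_X"

definition vq :: laurent where
  "vq = fls_const (Fract [:0, 1:] 1)"

definition eq_up_to_monomial :: "laurent \<Rightarrow> laurent \<Rightarrow> bool"  (infix "\<simeq>" 50) where
  "x \<simeq> y \<longleftrightarrow> (\<exists>s\<in>{1, -1}. \<exists>m n :: int. x = s * va powi m * vq powi n * y)"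

definition qpoch :: "laurent \<Rightarrow> nat \<Rightarrow> laurent" where
  "qpoch x r = (\<Prod>j<r. 1 - x * vq ^ (2 * j))"

definition qbracket :: "laurent \<Rightarrow> nat \<Rightarrow> laurent" where
  "qbracket y m = (1 - y ^ (2 * m)) / (1 - y ^ 2)"

definition elem_sym :: "nat \<Rightarrow> 'b set \<Rightarrow> ('b \<Rightarrow> laurent) \<Rightarrow> laurent" where
  "elem_sym i A x = (\<Sum>S \<in> {S. S \<subseteq> A \<and> card S = i}. \<Prod>l\<in>S. x l)"


section \<open>Oriented link diagrams\<close>

text \<open>
  An oriented diagram in Morse position is read from bottom to top as a word of pieces \<open>(i, g)\<close>.
  The strands on a horizontal line are numbered \<open>0, 1, \<dots>\<close> from left to right and their orientations
  form a list (\<open>True\<close> = upwards).  A cup \<open>Cup b\<close> at \<open>i\<close> creates strands \<open>i\<close> and \<open>i + 1\<close> with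
  orientations \<open>b\<close> and \<open>\<not> b\<close>; a cap joins the strands \<open>i\<close> and \<open>i + 1\<close>; in a crossing of the strands
  \<open>i\<close> and \<open>i + 1\<close> the strand running from bottom left to top right is the upper one for \<open>Cross True\<close>
  and the lower one for \<open>Cross False\<close>, whatever the orientations.
\<close>

datatype piece = Cup bool | Cap | Cross bool

type_synonym diagram = "(nat \<times> piece) list"

fun attach :: "nat \<times> piece \<Rightarrow> bool list \<Rightarrow> bool list option" where
  "attach (i, Cup b) st =
     (if i \<le> length st then Some (take i st @ [b, \<not> b] @ drop i st) else None)"
| "attach (i, Cap) st =
     (if Suc i < length st \<and> st ! i \<noteq> st ! Suc i then Some (take i st @ drop (i + 2) st) else None)"
| "attach (i, Cross s) st =
     (if Suc i < length st then Some (st[i := st ! Suc i, Suc i := st ! i]) else None)"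

fun run :: "diagram \<Rightarrow> bool list \<Rightarrow> bool list option" where
  "run [] st = Some st"
| "run (x # w) st = Option.bind (attach x st) (run w)"

definition link_diagram :: "diagram \<Rightarrow> bool" where
  "link_diagram D \<longleftrightarrow> run D [] = Some []"

definition unknot :: diagram where
  "unknot = [(0, Cup True), (0, Cap)]"

fun crossing_sign :: "bool list \<Rightarrow> nat \<times> piece \<Rightarrow> int" where
  "crossing_sign st (i, Cross s) = (if s = (st ! i = st ! Suc i) then 1 else - 1)"
| "crossing_sign st (i, Cup b) = 0"
| "crossing_sign st (i, Cap) = 0"

fun writhe_from :: "bool list \<Rightarrow> diagram \<Rightarrow> int" where
  "writhe_from st [] = 0"
| "writhe_from st (x # w) = crossing_sign st x + writhe_from (the (attach x st)) w"

definition writhe :: "diagram \<Rightarrow> int" where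
  "writhe D = writhe_from [] D"

text \<open>
  Isotopy of links is generated by the moves of Freyd--Yetter and Turaev for tangle diagrams in Morse
  position: distant pieces change height, a strand is straightened, a strand slides across a cup or
  a cap, and the three Reidemeister moves (the first one in the form of a kink at a cup or cap).
\<close>

fun ends_below :: "piece \<Rightarrow> nat" where
  "ends_below (Cup b) = 0"
| "ends_below Cap = 2"
| "ends_below (Cross s) = 2"

fun ends_above :: "piece \<Rightarrow> nat" where
  "ends_above (Cup b) = 2"
| "ends_above Cap = 0"
| "ends_above (Cross s) = 2"

inductive move :: "diagram \<Rightarrow> diagram \<Rightarrow> bool" where
  height: "i + ends_below g \<le> j \<Longrightarrow>
     move [(i, g), (j + ends_above g - ends_below g, h)] [(j, h), (i, g)]"
| zigzag_left: "move [(Suc i, Cup b), (i, Cap)] []"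
| zigzag_right: "move [(i, Cup b), (Suc i, Cap)] []"
| slide_cup: "move [(i, Cup b), (Suc i, Cross s)] [(Suc i, Cup b), (i, Cross (\<not> s))]"
| slide_cap: "move [(Suc i, Cross s), (i, Cap)] [(i, Cross (\<not> s)), (Suc i, Cap)]"
| reidemeister1_cup: "move [(i, Cup b), (i, Cross s)] [(i, Cup (\<not> b))]"
| reidemeister1_cap: "move [(i, Cross s), (i, Cap)] [(i, Cap)]"
| reidemeister2: "move [(i, Cross s), (i, Cross (\<not> s))] []"
| reidemeister3: "move [(i, Cross s), (Suc i, Cross s), (i, Cross s)]
                       [(Suc i, Cross s), (i, Cross s), (Suc i, Cross s)]"

inductive isotopic :: "diagram \<Rightarrow> diagram \<Rightarrow> bool" where
  refl: "link_diagram D \<Longrightarrow> isotopic D D"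
| move: "move x y \<Longrightarrow> link_diagram (u @ x @ v) \<Longrightarrow> link_diagram (u @ y @ v) \<Longrightarrow>
     isotopic (u @ x @ v) (u @ y @ v)"
| sym: "isotopic D E \<Longrightarrow> isotopic E D"
| trans: "isotopic D E \<Longrightarrow> isotopic E F \<Longrightarrow> isotopic D F"


section \<open>The HOMFLY-PT polynomial and its symmetric colourings\<close>

text \<open>
  The orientation-compatible smoothing of a crossing of the strands \<open>i\<close> and \<open>i + 1\<close> whose orientations
  below the crossing are listed in \<open>st\<close>.
\<close>

definition smoothing :: "bool list \<Rightarrow> nat \<Rightarrow> diagram" where
  "smoothing st i = (if st ! i = st ! Suc i then [] else [(i, Cap), (i, Cup (st ! Suc i))])"

text \<open>
  In the skein relation the positive crossing is the one called ``over'' in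
  \<open>a P(over) - a\<^sup>-\<^sup>1 P(under) = (q - q\<^sup>-\<^sup>1) P(0)\<close>; with this choice the left-handed trefoil has
  \<open>P = a\<^sup>2 q\<^sup>-\<^sup>2 + a\<^sup>2 q\<^sup>2 - a\<^sup>4\<close>.
\<close>

definition homflypt :: "(diagram \<Rightarrow> laurent) \<Rightarrow> bool" where
  "homflypt P \<longleftrightarrow>
     (\<forall>D E. isotopic D E \<longrightarrow> P D = P E) \<and>
     P unknot = 1 \<and>
     (\<forall>u v i st. run u [] = Some st \<longrightarrow> link_diagram (u @ [(i, Cross True)] @ v) \<longrightarrow>
        (let parallel = (st ! i = st ! Suc i) in
         va * P (u @ [(i, Cross parallel)] @ v) - inverse va * P (u @ [(i, Cross (\<not> parallel))] @ v)
           = (vq - inverse vq) * P (u @ smoothing st i @ v)))"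

text \<open>
  The framed, unreduced version \<open>\<langle>D\<rangle>\<close> is a regular isotopy invariant: it satisfies
  \<open>\<langle>D\<^sub>+\<rangle> - \<langle>D\<^sub>-\<rangle> = (q - q\<^sup>-\<^sup>1) \<langle>D\<^sub>0\<rangle>\<close>, and removing a positive kink divides it by \<open>a\<close>.
\<close>

definition framed :: "(diagram \<Rightarrow> laurent) \<Rightarrow> diagram \<Rightarrow> laurent" where
  "framed P D = va powi writhe D * ((va - inverse va) / (vq - inverse vq)) * P D"

text \<open>
  \<open>perm_braids r\<close> lists one reduced word for each of the \<open>r!\<close> permutations of \<open>r\<close> strands, by the coset
  decomposition of \<open>S\<^sub>n\<^sub>+\<^sub>1\<close> over \<open>S\<^sub>n\<close> with representatives \<open>\<sigma>\<^sub>n\<^sub>-\<^sub>1 \<sigma>\<^sub>n\<^sub>-\<^sub>2 \<cdots> \<sigma>\<^sub>n\<^sub>-\<^sub>k\<close> for \<open>0 \<le> k \<le> n\<close>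
  (\<open>\<sigma>\<^sub>j\<close> exchanges the strands \<open>j\<close> and \<open>j + 1\<close>, counted from \<open>0\<close>).
\<close>

fun perm_braids :: "nat \<Rightarrow> nat list list" where
  "perm_braids 0 = [[]]"
| "perm_braids (Suc n) = [w @ rev [n - k..<n]. w \<leftarrow> perm_braids n, k \<leftarrow> [0..<Suc n]]"

text \<open>
  The idempotent of the Hecke algebra that projects to \<open>Sym\<^sup>r\<close>, placed on the \<open>r\<close> parallel strands
  \<open>i, \<dots>, i + r - 1\<close>: the sum \<open>\<Sum>\<^sub>w q\<^bsup>l(w)\<^esup> T\<^sub>w\<close> of the positive permutation braids \<open>T\<^sub>w\<close>, divided by
  \<open>\<Sum>\<^sub>w q\<^bsup>2l(w)\<^esup>\<close>.  Formal linear combinations of diagrams are lists of pairs (coefficient, diagram).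
\<close>

definition symmetrizer :: "nat \<Rightarrow> nat \<Rightarrow> (laurent \<times> diagram) list" where
  "symmetrizer r i =
     (let d = (\<Sum>w\<leftarrow>perm_braids r. vq ^ (2 * length w))
      in [(vq ^ length w / d, map (\<lambda>j. (i + j, Cross True)) w). w \<leftarrow> perm_braids r])"

text \<open>
  Each strand is replaced by \<open>r\<close> parallel strands (in the blackboard framing), and a symmetrizer is
  placed above the left leg of every cup.  Every component has a cup; since symmetrizers slide along
  a component and are idempotent, this amounts to one symmetrizer on each component.
\<close>

fun cable_piece :: "nat \<Rightarrow> nat \<times> piece \<Rightarrow> (laurent \<times> diagram) list" where
  "cable_piece r (i, Cup b) =
     [(c, [(r * i + k, Cup b). k \<leftarrow> [0..<r]] @ w). (c, w) \<leftarrow> symmetrizer r (r * i)]"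
| "cable_piece r (i, Cap) = [(1, [(r * i + k, Cap). k \<leftarrow> rev [0..<r]])]"
| "cable_piece r (i, Cross s) =
     [(1, [(r * i + k + m, Cross s). k \<leftarrow> rev [0..<r], m \<leftarrow> [0..<r]])]"

fun cable :: "nat \<Rightarrow> diagram \<Rightarrow> (laurent \<times> diagram) list" where
  "cable r [] = [(1, [])]"
| "cable r (x # D) = [(c * d, u @ w). (c, u) \<leftarrow> cable_piece r x, (d, w) \<leftarrow> cable r D]"

text \<open>
  A positive kink on a strand coloured by \<open>Sym\<^sup>r\<close> contributes the factor \<open>a\<^sup>r q\<^bsup>r(r-1)\<^esup>\<close>, which the
  invariants below divide out; for \<open>r = 1\<close> the reduced one is \<open>P\<close> itself.
\<close>

definition unreduced_sym :: "(diagram \<Rightarrow> laurent) \<Rightarrow> nat \<Rightarrow> diagram \<Rightarrow> laurent" where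
  "unreduced_sym P r D =
     (va ^ r * vq ^ (r * (r - 1))) powi (- writhe D) * (\<Sum>(c, E)\<leftarrow>cable r D. c * framed P E)"

definition reduced_sym :: "(diagram \<Rightarrow> laurent) \<Rightarrow> nat \<Rightarrow> diagram \<Rightarrow> laurent" where
  "reduced_sym P r D = unreduced_sym P r D / unreduced_sym P r unknot"


section \<open>Twist regions with anti-parallel strands\<close>

definition twists :: "nat \<Rightarrow> int \<Rightarrow> diagram" where
  "twists p n = replicate (nat \<bar>n\<bar>) (p, Cross (0 \<le> n))"

text \<open>
  The twist region of \<open>K 1\<close> consists of the \<open>n\<close> crossings of the strands \<open>p\<close> and \<open>p + 1\<close> between \<open>u\<close> and
  \<open>v\<close> (any twist region has this shape after a planar isotopy); a full twist adds two crossings.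
  Crossings of the opposite handedness count negatively, as they cancel against added twists.
  Between anti-parallel strands \<open>Cross True\<close> is a negative crossing.  \<open>L\<close> is obtained from \<open>K 1\<close> by
  smoothing the last crossing of the region (for \<open>n \<le> 0\<close>, after inserting a cancelling pair of
  crossings), which turns the other ones into kinks; \<open>st'\<close> are the orientations below that crossing.
\<close>

definition antiparallel_twist_family :: "(nat \<Rightarrow> diagram) \<Rightarrow> diagram \<Rightarrow> bool" where
  "antiparallel_twist_family K L \<longleftrightarrow>
     (\<exists>u v p n st st'.
        run u [] = Some st \<and> Suc p < length st \<and> st ! p \<noteq> st ! Suc p \<and>
        run (u @ twists p (n - 1)) [] = Some st' \<and>
        (\<forall>j. isotopic (K j) (u @ twists p (n + 2 * (int j - 1)) @ v)) \<and>
        isotopic L (u @ twists p (n - 1) @ smoothing st' p @ v))"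

text \<open>
  \<open>F\<close> is the finite version of the invariant of \<open>L\<close>; the recursion fixes its monomial factor.
\<close>

definition is_finite_version ::
    "(diagram \<Rightarrow> laurent) \<Rightarrow> nat \<Rightarrow> (nat \<Rightarrow> diagram) \<Rightarrow> diagram \<Rightarrow> laurent \<Rightarrow> bool" where
  "is_finite_version P r K L F \<longleftrightarrow>
     F \<simeq> qpoch (vq ^ 2) r * reduced_sym P r L \<and>
     (\<forall>j. (\<Sum>i\<le>r. (- 1) ^ i * elem_sym i {1..r} (\<lambda>l. va ^ (2 * l) * vq ^ (2 * l * (l - 1)))
                     * reduced_sym P r (K (j + r - i)))
          = (\<Prod>l=1..r. qbracket (va * vq ^ (l - 1)) l) * F)"

definition finite_sym :: "(diagram \<Rightarrow> laurent) \<Rightarrow> nat \<Rightarrow> (nat \<Rightarrow> diagram) \<Rightarrow> diagram \<Rightarrow> laurent" where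
  "finite_sym P r K L = (THE F. is_finite_version P r K L F)"

end

theory Submission
  imports Defs
begin

text \<open>
  The recursion has constant right-hand side and characteristic roots \<open>\<lambda>\<^sub>1, \<dots>, \<lambda>\<^sub>r\<close> of positive order
  in \<open>a\<close>, so every solution converges \<open>a\<close>-adically to the right-hand side divided by
  \<open>\<Prod>\<^sub>l (1 - \<lambda>\<^sub>l)\<close>, and the numerators of the quantum brackets cancel this product.

  The unknot is the closure of the symmetrizer.  The trace of its innermost strand is computed by the
  coset decomposition of \<open>S\<^sub>n\<^sub>+\<^sub>1\<close> over \<open>S\<^sub>n\<close>: the trivial coset splits off a circle, each other one
  loses a positive kink (Markov move), and its remaining generators are absorbed by the symmetrizer on
  \<open>n\<close> strands, each with the factor \<open>q\<close>.  So adding a strand to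
  \<open>n\<close> strands multiplies the trace of the unnormalised symmetrizer by \<open>(a q\<^bsup>2n\<^esup> - a\<^sup>-\<^sup>1) / (q - q\<^sup>-\<^sup>1)\<close>.
\<close>

section \<open>Linear recursions over Laurent series\<close>

text \<open>The condition is put on coefficients because \<open>fls_subdegree 0\<close> is 0, while
  the zero series should have every order; sums that cancel then need no case distinction.\<close>

definition fls_order_ge :: "int \<Rightarrow> 'a::zero fls \<Rightarrow> bool" where
  "fls_order_ge N f \<longleftrightarrow> (\<forall>k<N. fls_nth f k = 0)"

lemma fls_order_ge_0 [simp]: "fls_order_ge N 0"
  by (simp add: fls_order_ge_def)

lemma fls_order_ge_mono: "fls_order_ge N f \<Longrightarrow> M \<le> N \<Longrightarrow> fls_order_ge M f"
  by (simp add: fls_order_ge_def)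

lemma fls_order_ge_subdegree: "fls_order_ge (fls_subdegree f) f"
  by (simp add: fls_order_ge_def)

lemma fls_order_ge_uminus: "fls_order_ge N f \<Longrightarrow> fls_order_ge N (- f)"
  for f :: "'a::ring_1 fls"
  by (simp add: fls_order_ge_def)

lemma fls_order_ge_sum:
  fixes f :: "'i \<Rightarrow> 'a::comm_ring_1 fls"
  shows "(\<And>i. i \<in> I \<Longrightarrow> fls_order_ge N (f i)) \<Longrightarrow> fls_order_ge N (sum f I)"
  by (induction I rule: infinite_finite_induct) (auto simp: fls_order_ge_def)

lemma fls_order_ge_mult:
  fixes f g :: "'a::comm_ring_1 fls"
  assumes "fls_order_ge N f" "fls_order_ge M g"
  shows "fls_order_ge (N + M) (f * g)"
proof (cases "f = 0 \<or> g = 0")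
  case False
  then have "N \<le> fls_subdegree f" "M \<le> fls_subdegree g"
    using assms by (auto intro!: fls_subdegree_geI simp: fls_order_ge_def)
  then show ?thesis
    by (auto simp: fls_order_ge_def intro!: fls_times_nth_eq0)
qed auto

text \<open>A nonzero difference of order at least \<open>m\<close> has norm at most
  \<open>inverse (2 ^ m)\<close> in the metric on Laurent series.\<close>

lemma fls_tendsto_if_order_ge:
  fixes x :: "nat \<Rightarrow> 'a::comm_ring_1 fls"
  assumes "\<And>m. \<forall>\<^sub>F n in sequentially. fls_order_ge (int m) (x n - l)"
  shows "x \<longlonglongrightarrow> l"
proof (rule tendstoI)
  fix e :: real assume "e > 0"
  then obtain m where m: "inverse (2 ^ m) < e"
    using real_arch_pow_inv[of e "1/2"] by (auto simp: field_simps power_divide)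
  show "\<forall>\<^sub>F n in sequentially. dist (x n) l < e"
    using assms[of m]
  proof eventually_elim
    case (elim n)
    show ?case
    proof (cases "x n = l")
      case False
      then have "int m \<le> fls_subdegree (x n - l)"
        using elim by (auto intro!: fls_subdegree_geI simp: fls_order_ge_def)
      then have "dist (x n) l \<le> inverse (2 ^ m)"
        using False by (auto simp: dist_fls_def intro!: le_imp_inverse_le power_increasing)
      then show ?thesis using m by simp
    qed (use \<open>e > 0\<close> in simp)
  qed
qed

text \<open>Subtracting the constant solution \<open>C / (\<Sum>i\<le>r. c i)\<close> makes the
  recursion homogeneous. Every later coefficient has positive order, so each block of
  \<open>r\<close> steps raises the order of the remainder by at least one.\<close>

lemma recursion_tendsto:
  fixes x c :: "nat \<Rightarrow> 'a::field fls"
  assumes rec: "\<And>j. (\<Sum>i\<le>r. c i * x (j + r - i)) = C"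
    and c0: "c 0 = 1"
    and small: "\<And>i. 1 \<le> i \<Longrightarrow> i \<le> r \<Longrightarrow> fls_order_ge 1 (c i)"
  shows "x \<longlonglongrightarrow> C / (\<Sum>i\<le>r. c i)"
proof -
  define S where "S = (\<Sum>i\<le>r. c i)"
  define y where "y = (\<lambda>n. x n - C / S)"
  have split: "{..r} = insert 0 {1..r}"
    by auto
  have "S = 1 + (\<Sum>i=1..r. c i)"
    by (simp add: S_def split c0)
  moreover have "fls_order_ge 1 (\<Sum>i=1..r. c i)"
    by (rule fls_order_ge_sum) (use small in auto)
  \<comment> \<open>Only \<open>c 0\<close> reaches the constant term, so \<open>S\<close> can be
    divided by.\<close>
  ultimately have "fls_nth S 0 = 1"
    by (simp add: fls_order_ge_def)
  then have S: "S \<noteq> 0"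
    by auto
  have "(\<Sum>i\<le>r. c i * y (j + r - i)) = 0" for j
  proof -
    have "(\<Sum>i\<le>r. c i * y (j + r - i)) = (\<Sum>i\<le>r. c i * x (j + r - i)) - S * (C / S)"
      by (simp only: y_def right_diff_distrib sum_subtractf sum_distrib_right S_def)
    then show ?thesis
      using rec[of j] S by simp
  qed
  then have step: "y (j + r) = - (\<Sum>i=1..r. c i * y (j + r - i))" for j
    using eq_neg_iff_add_eq_0 by (fastforce simp: split c0)
  \<comment> \<open>\<open>N\<close> bounds the orders of the \<open>r\<close> initial terms from
    below; the inserted 0 keeps the set nonempty when \<open>r = 0\<close>.\<close>
  define N where "N = Min (insert 0 ((\<lambda>n. fls_subdegree (y n)) ` {..<r}))"
  have grow: "fls_order_ge (N + int m) (y n)" if "r * m \<le> n" for m n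
    using that
  proof (induction n arbitrary: m rule: less_induct)
    case (less n)
    show ?case
    proof (cases "n < r")
      case True
      then have "m = 0"
        using less.prems by (cases m) auto
      moreover have "N \<le> fls_subdegree (y n)"
        unfolding N_def using True by (intro Min_le) auto
      ultimately show ?thesis
        using fls_order_ge_mono[OF fls_order_ge_subdegree] by simp
    next
      case False
      define j where "j = n - r"
      then have n: "n = j + r"
        using False by simp
      have "fls_order_ge (N + int m) (c i * y (j + r - i))" if i: "i \<in> {1..r}" for i
      proof -
        \<comment> \<open>Going back at most \<open>r\<close> indices loses at most one block. For
          \<open>m = 0\<close> the truncated \<open>m - 1\<close> is again 0.\<close>
        have "r * (m - 1) \<le> j + r - i"
          using less.prems i by (cases m) (auto simp: n)
        then have "fls_order_ge (N + int (m - 1)) (y (j + r - i))"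
          using i by (intro less.IH) (auto simp: n)
        moreover have "fls_order_ge 1 (c i)"
          using small i by simp
        ultimately have "fls_order_ge (1 + (N + int (m - 1))) (c i * y (j + r - i))"
          by (rule fls_order_ge_mult[rotated])
        then show ?thesis
          by (rule fls_order_ge_mono) simp
      qed
      then show ?thesis
        unfolding n step by (intro fls_order_ge_uminus fls_order_ge_sum)
    qed
  qed
  have "\<forall>\<^sub>F n in sequentially. fls_order_ge (int m) (x n - C / S)" for m
  proof (rule eventually_sequentiallyI)
    \<comment> \<open>The extra \<open>nat (- N)\<close> blocks make up for a negative initial
      order.\<close>
    fix n assume "r * (m + nat (- N)) \<le> n"
    from fls_order_ge_mono[OF grow[OF this], of "int m"]
    show "fls_order_ge (int m) (x n - C / S)"
      by (simp add: y_def)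
  qed
  then show ?thesis
    unfolding S_def by (rule fls_tendsto_if_order_ge)
qed

section \<open>Elementary symmetric polynomials\<close>

lemma elem_sym_0: "finite A \<Longrightarrow> elem_sym 0 A x = 1"
proof -
  assume "finite A"
  then have "{S. S \<subseteq> A \<and> card S = 0} = {{}}"
    by (auto simp: finite_subset)
  then show ?thesis by (simp add: elem_sym_def)
qed

text \<open>The product expands into a sum over subsets of \<open>A\<close>, which is then grouped
  by cardinality.\<close>

lemma sum_elem_sym:
  assumes "finite A"
  shows "(\<Sum>i\<le>card A. (- 1) ^ i * elem_sym i A x) = (\<Prod>l\<in>A. 1 - x l)"
proof -
  have "(\<Prod>l\<in>A. 1 - x l) = (\<Sum>S\<in>Pow A. (-1) ^ card S * (\<Prod>l\<in>S. x l))"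
    using prod_diff_conv_sum[OF assms, of "\<lambda>_. 1" x] by simp
  also have "\<dots> = (\<Sum>i\<le>card A. \<Sum>S\<in>{S \<in> Pow A. card S = i}. (-1) ^ card S * (\<Prod>l\<in>S. x l))"
    by (rule sum.group[symmetric]) (use assms in \<open>auto intro: card_mono\<close>)
  also have "\<dots> = (\<Sum>i\<le>card A. (-1) ^ i * elem_sym i A x)"
    by (auto simp: elem_sym_def sum_distrib_left intro!: sum.cong)
  finally show ?thesis ..
qed

lemma fls_order_ge_elem_sym:
  assumes "finite A" "1 \<le> i" "\<And>l. l \<in> A \<Longrightarrow> fls_order_ge 1 (x l)"
  shows "fls_order_ge 1 (elem_sym i A x)"
  unfolding elem_sym_def
proof (rule fls_order_ge_sum)
  fix S assume "S \<in> {S. S \<subseteq> A \<and> card S = i}"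
  then have S: "S \<subseteq> A" "finite S" "S \<noteq> {}"
    using assms by (auto intro: finite_subset)
  show "fls_order_ge 1 (\<Prod>l\<in>S. x l)"
    using S(2,3,1)
  proof (induction rule: finite_ne_induct)
    case (insert l S)
    then have "fls_order_ge (1 + 1) (x l * (\<Prod>l\<in>S. x l))"
      using assms(3) by (intro fls_order_ge_mult) auto
    then show ?case
      using insert by (auto intro: fls_order_ge_mono)
  qed (use assms(3) in auto)
qed

section \<open>Monomials in \<open>a\<close> and \<open>q\<close>\<close>

lemma va_nonzero [simp]: "va \<noteq> 0"
  by (simp add: va_def)

lemma vq_power: "vq ^ n = fls_const (Fract (monom 1 n) 1)"
proof -
  have "Fract [:0, 1::rat:] 1 ^ n = Fract (monom 1 n) 1"
    by (induction n) (simp_all add: One_fract_def monom_Suc one_pCons)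
  then show ?thesis
    by (simp add: vq_def flip: fls_const_power)
qed

lemma vq_nonzero [simp]: "vq \<noteq> 0"
  by (simp add: vq_def Zero_fract_def eq_fract)

text \<open>\<open>vq\<close> is an indeterminate: the degree of the monomial decides.\<close>

lemma vq_power_eq_1_iff: "vq ^ n = 1 \<longleftrightarrow> n = 0"
proof
  assume "vq ^ n = 1"
  then have "monom (1::rat) n = 1"
    unfolding vq_power by (simp add: One_fract_def eq_fract)
  then show "n = 0"
    using degree_monom_eq[of "1::rat" n] by simp
qed simp

lemma va_vq_nth: "fls_nth (va ^ m * vq ^ n) k = (if k = int m then Fract (monom 1 n) 1 else 0)"
  by (simp add: va_def vq_power)

lemma fls_order_ge_va_vq: "1 \<le> m \<Longrightarrow> fls_order_ge 1 (va ^ m * vq ^ n)"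
  unfolding fls_order_ge_def va_vq_nth by auto

lemma one_minus_va_vq_nonzero:
  assumes "1 \<le> m" shows "1 - va ^ m * vq ^ n \<noteq> 0"
proof
  assume "1 - va ^ m * vq ^ n = 0"
  then have "fls_nth (1 - va ^ m * vq ^ n) 0 = 0" by simp
  then show False
    using assms unfolding fls_minus_nth va_vq_nth by simp
qed

lemma qpoch_va_nonzero: "qpoch (va ^ 2) r \<noteq> 0"
  using one_minus_va_vq_nonzero by (simp add: qpoch_def)

lemma qpoch_vq_nonzero: "qpoch (vq ^ 2) r \<noteq> 0"
proof -
  have "vq ^ 2 * vq ^ (2 * j) \<noteq> 1" for j
    using vq_power_eq_1_iff[of "2 + 2 * j"] unfolding power_add by simp
  then show ?thesis
    by (auto simp: qpoch_def)
qed

text \<open>The numerator of the bracket with index \<open>l\<close> is one minus the root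
  \<open>\<lambda>_l\<close>, since \<open>(va * vq ^ (l - 1)) ^ (2 * l)\<close> is that root; the
  denominators are the factors of \<open>qpoch (va ^ 2) r\<close>.\<close>

lemma prod_qbracket:
  "(\<Prod>l=1..r. qbracket (va * vq ^ (l - 1)) l) =
     (\<Prod>l=1..r. 1 - va ^ (2 * l) * vq ^ (2 * l * (l - 1))) / qpoch (va ^ 2) r"
proof -
  have "(\<Prod>l=1..r. 1 - (va * vq ^ (l - 1)) ^ 2) = qpoch (va ^ 2) r"
    unfolding qpoch_def
    by (rule prod.reindex_bij_witness[of _ Suc "\<lambda>l. l - 1"])
       (auto simp: power_mult_distrib mult.commute simp flip: power_mult)
  moreover have "(\<Prod>l=1..r. 1 - (va * vq ^ (l - 1)) ^ (2 * l)) =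
      (\<Prod>l=1..r. 1 - va ^ (2 * l) * vq ^ (2 * l * (l - 1)))"
    by (simp add: power_mult_distrib mult.commute flip: power_mult)
  ultimately show ?thesis
    unfolding qbracket_def prod_dividef by simp
qed

lemma eq_up_to_monomialI:
  "x = va powi m * vq powi n * y \<Longrightarrow> x \<simeq> y"
  unfolding eq_up_to_monomial_def by auto

lemma eq_up_to_monomial_divide:
  assumes "x \<simeq> y" "u \<simeq> v"
  shows "x / u \<simeq> y / v"
proof -
  obtain s m n where x: "s \<in> {1, -1}" "x = s * va powi m * vq powi n * y"
    using assms(1) unfolding eq_up_to_monomial_def by blast
  obtain t k l where u: "t \<in> {1, -1}" "u = t * va powi k * vq powi l * v"
    using assms(2) unfolding eq_up_to_monomial_def by blast
  \<comment> \<open>A sign is its own inverse, so \<open>s * t\<close> stands for the quotient of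
    the signs.\<close>
  have "x / u = (s * t) * va powi (m - k) * vq powi (n - l) * (y / v)"
    using u(1) by (auto simp: x(2) u(2) power_int_diff)
  then show ?thesis
    unfolding eq_up_to_monomial_def using x(1) u(1)
    by (intro bexI[of _ "s * t"]) auto
qed

section \<open>Hecke relations and the symmetrizer\<close>

lemma perm_braids_letters: "w \<in> set (perm_braids n) \<Longrightarrow> j \<in> set w \<Longrightarrow> Suc j < n"
  by (induction n arbitrary: w) fastforce+

lemma sum_list_concat_map: "(\<Sum>x\<leftarrow>concat (map f xs). g x) = (\<Sum>y\<leftarrow>xs. \<Sum>x\<leftarrow>f y. g x)"
  by (induction xs) simp_all

lemma sum_list_map_cong:
  "(\<And>x. x \<in> set xs \<Longrightarrow> f x = g x) \<Longrightarrow> (\<Sum>x\<leftarrow>xs. f x) = (\<Sum>x\<leftarrow>xs. g x)"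
  by (induction xs) simp_all

lemma sum_list_sum:
  fixes f :: "'b \<Rightarrow> 'c \<Rightarrow> 'a::comm_monoid_add"
  shows "(\<Sum>x\<leftarrow>xs. \<Sum>k\<in>I. f x k) = (\<Sum>k\<in>I. \<Sum>x\<leftarrow>xs. f x k)"
  by (induction xs) (simp_all add: sum.distrib)

text \<open>The sum over the cosets is put outside, so that each coset representative can be treated
  on its own.\<close>

lemma sum_perm_braids_Suc:
  fixes f :: "nat list \<Rightarrow> 'a::comm_monoid_add"
  shows "(\<Sum>w\<leftarrow>perm_braids (Suc n). f w) =
           (\<Sum>k\<le>n. \<Sum>w\<leftarrow>perm_braids n. f (w @ rev [n - k..<n]))"
proof -
  have "(\<Sum>w\<leftarrow>perm_braids (Suc n). f w) =
      (\<Sum>w\<leftarrow>perm_braids n. \<Sum>k\<leftarrow>[0..<Suc n]. f (w @ rev [n - k..<n]))"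
    by (simp add: sum_list_concat_map o_def del: upt_Suc)
  also have "\<dots> = (\<Sum>w\<leftarrow>perm_braids n. \<Sum>k\<le>n. f (w @ rev [n - k..<n]))"
    by (simp add: interv_sum_list_conv_sum_set_nat atLeast0LessThan lessThan_Suc_atMost del: upt_Suc)
  also have "\<dots> = (\<Sum>k\<le>n. \<Sum>w\<leftarrow>perm_braids n. f (w @ rev [n - k..<n]))"
    by (rule sum_list_sum)
  finally show ?thesis .
qed

text \<open>
  A linear functional on the Hecke algebra with generators \<open>T\<^sub>0, \<dots>, T\<^sub>N\<^sub>-\<^sub>1\<close>, given by its values on
  words in the generators.
\<close>

locale hecke_functional =
  fixes \<phi> :: "nat list \<Rightarrow> 'a::field" and N :: nat and q :: 'a
  assumes q_nonzero: "q \<noteq> 0"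
    and far: "\<lbrakk>x \<in> lists {..<N}; y \<in> lists {..<N}; i < N; j < N; i + 2 \<le> j\<rbrakk>
      \<Longrightarrow> \<phi> (x @ [i, j] @ y) = \<phi> (x @ [j, i] @ y)"
    and braid: "\<lbrakk>x \<in> lists {..<N}; y \<in> lists {..<N}; Suc i < N\<rbrakk>
      \<Longrightarrow> \<phi> (x @ [i, Suc i, i] @ y) = \<phi> (x @ [Suc i, i, Suc i] @ y)"
    and quadratic: "\<lbrakk>x \<in> lists {..<N}; y \<in> lists {..<N}; i < N\<rbrakk>
      \<Longrightarrow> \<phi> (x @ [i, i] @ y) = (q - inverse q) * \<phi> (x @ [i] @ y) + \<phi> (x @ y)"
begin

lemma far_word:
  assumes "x \<in> lists {..<N}" "y \<in> lists {..<N}" "v \<in> lists {..<N}" "i < N"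
    and "\<And>j. j \<in> set v \<Longrightarrow> i + 2 \<le> j \<or> j + 2 \<le> i"
  shows "\<phi> (x @ [i] @ v @ y) = \<phi> (x @ v @ [i] @ y)"
  using assms
proof (induction v arbitrary: x)
  case (Cons j v)
  \<comment> \<open>If \<open>j\<close> is the smaller letter, \<open>far\<close> is used with the
    letters exchanged and read backwards.\<close>
  have "\<phi> (x @ [i, j] @ (v @ y)) = \<phi> (x @ [j, i] @ (v @ y))"
    using far[of x "v @ y" i j] far[of x "v @ y" j i] Cons.prems by fastforce
  moreover have "\<phi> ((x @ [j]) @ [i] @ v @ y) = \<phi> ((x @ [j]) @ v @ [i] @ y)"
    by (rule Cons.IH) (use Cons.prems in auto)
  ultimately show ?case
    by simp
qed simp

text \<open>This is \<open>\<phi>\<close> of the unnormalised symmetrizer on \<open>n\<close>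
  strands times the word \<open>y\<close>.\<close>

definition sym_sum :: "nat \<Rightarrow> nat list \<Rightarrow> 'a" where
  "sym_sum n y = (\<Sum>w\<leftarrow>perm_braids n. q ^ length w * \<phi> (w @ y))"

lemma sym_sum_Suc: "sym_sum (Suc n) y = (\<Sum>k\<le>n. q ^ k * sym_sum n (rev [n - k..<n] @ y))"
  unfolding sym_sum_def sum_perm_braids_Suc
  by (intro sum.cong) (simp_all add: power_add mult_ac flip: sum_list_const_mult)

lemma sym_sum_cong:
  assumes "n \<le> Suc N" "\<And>x. x \<in> lists {..<N} \<Longrightarrow> \<phi> (x @ y) = \<phi> (x @ z)"
  shows "sym_sum n y = sym_sum n z"
proof -
  have "w \<in> lists {..<N}" if "w \<in> set (perm_braids n)" for w
    using perm_braids_letters[OF that] assms(1) by fastforce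
  then show ?thesis
    unfolding sym_sum_def using assms(2) by (intro sum_list_map_cong) simp
qed

text \<open>
  The coset representative \<open>c\<^sub>k = T\<^sub>n\<^sub>-\<^sub>1 \<cdots> T\<^sub>n\<^sub>-\<^sub>k\<close> satisfies \<open>c\<^sub>k T\<^sub>i = T\<^sub>i c\<^sub>k\<close> for \<open>k < n - i - 1\<close> and
  \<open>c\<^sub>k T\<^sub>i = T\<^sub>i\<^sub>-\<^sub>1 c\<^sub>k\<close> for \<open>k > n - i\<close>, which leaves the block of \<open>c\<^sub>n\<^sub>-\<^sub>i\<^sub>-\<^sub>1\<close> and \<open>c\<^sub>n\<^sub>-\<^sub>i\<close>; there the quadratic
  relation applies.
\<close>

lemma sym_sum_absorb:
  assumes "n \<le> Suc N" "Suc i < n" "y \<in> lists {..<N}"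
  shows "sym_sum n (i # y) = q * sym_sum n y"
  using assms
proof (induction n arbitrary: i y)
  case (Suc n)
  define c where "c = (\<lambda>k. rev [n - k..<n])"
  have i: "i < n" and n: "n \<le> N"
    using Suc.prems by auto
  have c: "c k \<in> lists {..<N}" for k
    using n by (auto simp: c_def)
  \<comment> \<open>\<open>c k0\<close> stops just before the letter \<open>i\<close> and
    \<open>c (Suc k0)\<close> ends with it; multiplication by \<open>i\<close> mixes these two
    cosets only.\<close>
  define k0 where "k0 = n - i - 1"
  have k0: "n - Suc k0 = i" "n - k0 = Suc i" "k0 < n" "i + k0 + 1 = n"
    using i by (auto simp: k0_def)
  have c_Suc: "c (Suc k0) = c k0 @ [i]"
    unfolding c_def k0 using i by (subst (1) upt_conv_Cons) auto
  have low: "sym_sum n (c k @ i # y) = q * sym_sum n (c k @ y)" if "k < k0" for k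
  proof -
    have "sym_sum n (c k @ [i] @ y) = sym_sum n ([i] @ c k @ y)"
    proof (rule sym_sum_cong)
      show "\<phi> (x @ c k @ [i] @ y) = \<phi> (x @ [i] @ c k @ y)" if "x \<in> lists {..<N}" for x
        by (rule far_word[symmetric])
           (use that c Suc.prems n i \<open>k < k0\<close> k0 in \<open>auto simp: c_def\<close>)
    qed (use n in simp)
    also have "\<dots> = q * sym_sum n (c k @ y)"
      using Suc.IH[of i "c k @ y"] c[of k] Suc.prems n that k0 by auto
    finally show ?thesis by simp
  qed
  have high: "sym_sum n (c k @ i # y) = q * sym_sum n (c k @ y)" if k: "Suc k0 < k" "k \<le> n" for k
  proof -
    obtain m where m: "i = Suc m"
      using k k0 by (cases i) auto
    define u v where "u = rev [Suc i..<n]" and "v = rev [n - k..<m]"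
    have uv: "u \<in> lists {..<N}" "v \<in> lists {..<N}"
      using n i m by (auto simp: u_def v_def)
    have "[n - k..<n] = [n - k..<m] @ [m, i] @ [Suc i..<n]"
    proof -
      have "[n - k..<n] = [n - k..<m] @ [m..<n]"
        using k k0 i m upt_add_eq_append[of "n - k" m "n - m"] by simp
      then show ?thesis
        using i m by (simp add: upt_conv_Cons)
    qed
    then have ck: "c k = u @ [i, m] @ v"
      by (simp add: c_def u_def v_def)
    have "sym_sum n (c k @ [i] @ y) = sym_sum n ([m] @ c k @ y)"
    proof (rule sym_sum_cong)
      fix x assume x: "x \<in> lists {..<N}"
      \<comment> \<open>The letter \<open>i\<close> passes \<open>v\<close>, whose letters are below
        \<open>m\<close>; the braid relation turns \<open>i, m, i\<close> into
        \<open>m, i, m\<close>; the leading \<open>m\<close> then passes \<open>u\<close>, whose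
        letters exceed \<open>i\<close>.\<close>
      have "\<phi> ((x @ u @ [i, m]) @ v @ [i] @ y) = \<phi> ((x @ u @ [i, m]) @ [i] @ v @ y)"
        by (rule far_word[symmetric]) (use x uv Suc.prems i n m in \<open>auto simp: v_def\<close>)
      also have "\<dots> = \<phi> ((x @ u) @ [m, i, m] @ (v @ y))"
        using braid[of "x @ u" "v @ y" m] x uv Suc.prems i n m by simp
      also have "\<dots> = \<phi> (x @ u @ [m] @ ([i, m] @ v @ y))"
        by simp
      also have "\<dots> = \<phi> (x @ [m] @ u @ ([i, m] @ v @ y))"
        by (rule far_word[symmetric]) (use x uv Suc.prems i n m in \<open>auto simp: u_def\<close>)
      finally show "\<phi> (x @ c k @ [i] @ y) = \<phi> (x @ [m] @ c k @ y)"
        by (simp add: ck)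
    qed (use n in simp)
    also have "\<dots> = q * sym_sum n (c k @ y)"
      using Suc.IH[of m "c k @ y"] c[of k] Suc.prems n i m by auto
    finally show ?thesis by simp
  qed
  have mid0: "sym_sum n (c k0 @ i # y) = sym_sum n (c (Suc k0) @ y)"
    by (simp add: c_Suc)
  have mid1: "sym_sum n (c (Suc k0) @ i # y) =
      (q - inverse q) * sym_sum n (c (Suc k0) @ y) + sym_sum n (c k0 @ y)"
  proof -
    have "\<phi> (w @ c (Suc k0) @ i # y) =
        (q - inverse q) * \<phi> (w @ c (Suc k0) @ y) + \<phi> (w @ c k0 @ y)"
      if "w \<in> set (perm_braids n)" for w
      using quadratic[of "w @ c k0" y i] c[of k0] perm_braids_letters[OF that] Suc.prems i n
      by (fastforce simp: c_Suc)
    then have "q ^ length w * \<phi> (w @ c (Suc k0) @ i # y) =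
        (q - inverse q) * (q ^ length w * \<phi> (w @ c (Suc k0) @ y)) + q ^ length w * \<phi> (w @ c k0 @ y)"
      if "w \<in> set (perm_braids n)" for w
      using that by (metis distrib_left mult.left_commute)
    then have "sym_sum n (c (Suc k0) @ i # y) = (\<Sum>w\<leftarrow>perm_braids n.
        (q - inverse q) * (q ^ length w * \<phi> (w @ c (Suc k0) @ y)) + q ^ length w * \<phi> (w @ c k0 @ y))"
      unfolding sym_sum_def by (rule sum_list_map_cong)
    then show ?thesis
      unfolding sym_sum_def by (simp add: sum_list_addf sum_list_const_mult)
  qed
  \<comment> \<open>\<open>D k\<close> measures how far the coset \<open>k\<close> alone is from
    absorbing \<open>i\<close>.\<close>
  define D where "D = (\<lambda>k. q ^ k * (sym_sum n (c k @ i # y) - q * sym_sum n (c k @ y)))"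
  have "sym_sum (Suc n) (i # y) - q * sym_sum (Suc n) y = (\<Sum>k\<le>n. D k)"
    unfolding sym_sum_Suc D_def c_def
    by (simp add: sum_distrib_left right_diff_distrib mult.left_commute sum_subtractf)
  also have "\<dots> = (\<Sum>k\<in>{k0, Suc k0}. D k)"
  proof (rule sum.mono_neutral_right)
    show "\<forall>k\<in>{..n} - {k0, Suc k0}. D k = 0"
    proof
      fix k assume "k \<in> {..n} - {k0, Suc k0}"
      then have "k < k0 \<or> Suc k0 < k \<and> k \<le> n" by auto
      then show "D k = 0"
        using low high by (auto simp: D_def)
    qed
  qed (use k0 in auto)
  also have "\<dots> = D k0 + D (Suc k0)"
    by simp
  \<comment> \<open>With \<open>s\<close> and \<open>t\<close> the values for \<open>c k0\<close>
    and \<open>c (Suc k0)\<close>, the defects are \<open>q ^ k0 * (t - q * s)\<close> and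
    \<open>q ^ Suc k0 * (s - inverse q * t)\<close>, which cancel.\<close>
  also have "\<dots> = 0"
    using q_nonzero unfolding D_def mid0 mid1 by (simp add: field_simps)
  finally show ?case by simp
qed simp

lemma sym_sum_absorb_word:
  assumes "n \<le> Suc N" "\<And>j. j \<in> set v \<Longrightarrow> Suc j < n"
  shows "sym_sum n v = q ^ length v * sym_sum n []"
  using assms
proof (induction v)
  case (Cons i v)
  have "v \<in> lists {..<N}"
    using Cons.prems by fastforce
  then have "sym_sum n (i # v) = q * sym_sum n v"
    using Cons.prems by (intro sym_sum_absorb) auto
  then show ?case
    using Cons by simp
qed simp

end

section \<open>Closed braids\<close>

lemma run_append: "run (x @ y) st = Option.bind (run x st) (run y)"
  by (induction x arbitrary: st) (auto split: Option.bind_splits)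

lemma writhe_from_append:
  "run x st = Some st' \<Longrightarrow> writhe_from st (x @ y) = writhe_from st x + writhe_from st' y"
  by (induction x arbitrary: st) (auto split: Option.bind_splits)

definition is_braid :: "nat \<Rightarrow> diagram \<Rightarrow> bool" where
  "is_braid n D \<longleftrightarrow> (\<forall>(j, g)\<in>set D. Suc j < n \<and> (\<exists>s. g = Cross s))"

lemma is_braid_simps [simp]:
  "is_braid n []"
  "is_braid n ((j, Cross s) # D) \<longleftrightarrow> Suc j < n \<and> is_braid n D"
  "is_braid n (x @ y) \<longleftrightarrow> is_braid n x \<and> is_braid n y"
  unfolding is_braid_def by (simp_all add: ball_Un)

lemma is_braid_ConsE:
  assumes "is_braid n (a # D)"
  obtains j s where "a = (j, Cross s)" "Suc j < n" "is_braid n D"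
  using assms by (cases a) (auto simp: is_braid_def)

lemma attach_Cup_at: "length p = i \<Longrightarrow> attach (i, Cup b) (p @ z) = Some (p @ [b, \<not> b] @ z)"
  by auto

lemma attach_Cross_at:
  "length p = i \<Longrightarrow> attach (i, Cross s) (p @ [a, b] @ z) = Some (p @ [b, a] @ z)"
  by (auto simp: nth_append list_update_append)

lemma attach_Cap_at:
  "length p = i \<Longrightarrow> a \<noteq> b \<Longrightarrow> attach (i, Cap) (p @ [a, b] @ z) = Some (p @ z)"
  by (auto simp: nth_append)

text \<open>Exchanging two upward strands does not change the list of orientations. The list
  \<open>z\<close> belongs to strands right of the braid, such as the returning strands of a
  closure.\<close>

lemma attach_cross_up:
  "Suc j < n \<Longrightarrow> attach (j, Cross s) (replicate n True @ z) = Some (replicate n True @ z)"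
  by (auto simp: nth_append list_eq_iff_nth_eq nth_list_update)

lemma run_braid: "is_braid n D \<Longrightarrow> run D (replicate n True @ z) = Some (replicate n True @ z)"
  by (induction D) (auto simp: attach_cross_up simp del: attach.simps elim!: is_braid_ConsE)

text \<open>Between upward strands the sign of a crossing is read off from its piece, without
  tracking orientations.\<close>

definition braid_writhe :: "diagram \<Rightarrow> int" where
  "braid_writhe D = (\<Sum>x\<leftarrow>D. if snd x = Cross True then 1 else - 1)"

lemma braid_writhe_simps [simp]:
  "braid_writhe [] = 0"
  "braid_writhe ((j, Cross s) # D) = (if s then 1 else - 1) + braid_writhe D"
  "braid_writhe (x @ y) = braid_writhe x + braid_writhe y"
  by (simp_all add: braid_writhe_def)

lemma writhe_from_braid:
  "is_braid n D \<Longrightarrow> writhe_from (replicate n True @ z) D = braid_writhe D"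
proof (induction D)
  case (Cons a D)
  then obtain j s where a: "a = (j, Cross s)" "Suc j < n" "is_braid n D"
    by (auto elim: is_braid_ConsE)
  then have "crossing_sign (replicate n True @ z) a = (if s then 1 else - 1)"
    by (simp add: nth_append)
  then show ?case
    using a Cons.IH
    by (simp add: attach_cross_up del: attach.simps crossing_sign.simps)
qed simp

section \<open>Standard closures of braids\<close>

definition cups :: "nat \<Rightarrow> diagram" where
  "cups n = map (\<lambda>k. (k, Cup True)) [0..<n]"

definition caps :: "nat \<Rightarrow> diagram" where
  "caps n = map (\<lambda>k. (k, Cap)) (rev [0..<n])"

text \<open>The closing arcs are nested. In \<open>closure (Suc n)\<close> the strand
  \<open>n\<close> has the innermost arc, so it is the one that the Markov move removes.\<close>

definition closure :: "nat \<Rightarrow> diagram \<Rightarrow> diagram" where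
  "closure n D = cups n @ D @ caps n"

lemma cups_Suc: "cups (Suc n) = cups n @ [(n, Cup True)]"
  by (simp add: cups_def)

lemma caps_Suc: "caps (Suc n) = (n, Cap) # caps n"
  by (simp add: caps_def)

lemma run_cups: "run (cups n) [] = Some (replicate n True @ replicate n False)"
  by (induction n) (simp_all add: cups_def run_append replicate_app_Cons_same)

lemma run_caps: "run (caps n) (replicate n True @ replicate n False) = Some []"
proof (induction n)
  case (Suc n)
  have "attach (n, Cap) (replicate (Suc n) True @ replicate (Suc n) False) =
      Some (replicate n True @ replicate n False)"
    by (simp add: nth_append replicate_app_Cons_same del: replicate_Suc)
  then show ?case
    using Suc by (simp only: caps_Suc run.simps bind.simps)
qed (simp add: caps_def)

lemma writhe_from_cups: "writhe_from st (cups n) = 0"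
proof -
  have "writhe_from st (map (\<lambda>k. (k, Cup True)) ks) = 0" for ks
    by (induction ks arbitrary: st) simp_all
  then show ?thesis by (simp add: cups_def)
qed

lemma writhe_from_caps: "writhe_from st (caps n) = 0"
proof -
  have "writhe_from st (map (\<lambda>k. (k, Cap)) ks) = 0" for ks
    by (induction ks arbitrary: st) simp_all
  then show ?thesis by (simp add: caps_def)
qed

lemma link_diagram_closure: "is_braid n D \<Longrightarrow> link_diagram (closure n D)"
  by (simp add: link_diagram_def closure_def run_append run_cups run_braid run_caps)

lemma writhe_closure: "is_braid n D \<Longrightarrow> writhe (closure n D) = braid_writhe D"
  by (simp add: writhe_def closure_def writhe_from_append[OF run_cups]
      writhe_from_append[OF run_braid] writhe_from_cups writhe_from_caps writhe_from_braid)

section \<open>Isotopies of closed braids\<close>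

lemma isotopic_closure:
  assumes "move a b" "is_braid n (x @ a @ y)" "is_braid n (x @ b @ y)"
  shows "isotopic (closure n (x @ a @ y)) (closure n (x @ b @ y))"
  using isotopic.move[OF assms(1), of "cups n @ x" "y @ caps n"]
    link_diagram_closure[OF assms(2)] link_diagram_closure[OF assms(3)]
  by (simp add: closure_def)

text \<open>The piece \<open>h\<close> lies right of all braid strands and passes below one crossing
  at a time. Taking the height move as an assumption covers cups and caps at once.\<close>

lemma isotopic_slide:
  assumes commute: "\<And>j s. Suc j < n \<Longrightarrow> move [(j, Cross s), (n, h)] [(n, h), (j, Cross s)]"
    and "is_braid n x" "run u [] = Some (replicate n True @ z)"
    and "attach (n, h) (replicate n True @ z) = Some (replicate n True @ z')"
    and "link_diagram (u @ x @ [(n, h)] @ v)"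
  shows "isotopic (u @ x @ [(n, h)] @ v) (u @ [(n, h)] @ x @ v)"
  using assms(2-)
proof (induction x arbitrary: u)
  case (Cons a x)
  then obtain j s where a: "a = (j, Cross s)" "Suc j < n" "is_braid n x"
    by (auto elim: is_braid_ConsE)
  let ?st = "replicate n True @ z" and ?st' = "replicate n True @ z'"
  have v: "run v ?st' = Some []"
    using Cons.prems run_braid[OF Cons.prems(1), of z]
    by (simp add: link_diagram_def run_append del: attach.simps run.simps append_Cons) simp
  have run: "run (u @ [a]) [] = Some ?st"
    using Cons.prems a by (simp add: run_append attach_cross_up del: attach.simps)
  have "isotopic ((u @ [a]) @ x @ [(n, h)] @ v) ((u @ [a]) @ [(n, h)] @ x @ v)"
    using Cons.prems a run by (intro Cons.IH) simp_all
  moreover have "isotopic (u @ [a, (n, h)] @ (x @ v)) (u @ [(n, h), a] @ (x @ v))"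
    unfolding a(1)
  proof (rule isotopic.move[OF commute])
    show "link_diagram (u @ [(j, Cross s), (n, h)] @ x @ v)"
      "link_diagram (u @ [(n, h), (j, Cross s)] @ x @ v)"
      using Cons.prems a v
      by (simp_all add: link_diagram_def run_append attach_cross_up run_braid del: attach.simps)
  qed (fact a(2))
  ultimately show ?case
    by (auto intro: isotopic.trans)
qed (auto intro: isotopic.refl)

text \<open>Sliding the strand across the cup turns the crossing into a kink at the cap. The first
  Reidemeister move removes it, and the zigzag that remains is straightened.\<close>

lemma isotopic_kink:
  assumes run: "run u [] = Some (replicate (Suc m) True @ z)"
    and link: "link_diagram (u @ v)"
  shows "isotopic (u @ [(Suc m, Cup True), (m, Cross s), (Suc m, Cap)] @ v) (u @ v)"
proof -
  have v: "run v (replicate (Suc m) True @ z) = Some []"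
    using run link by (simp add: link_diagram_def run_append)
  have eval: "link_diagram (u @ w @ v)"
    if "run w (replicate (Suc m) True @ z) = Some (replicate (Suc m) True @ z)" for w
    using run v that by (simp add: link_diagram_def run_append)
  let ?p = "replicate m True"
  have rep: "replicate (Suc m) True @ z = ?p @ [True] @ z"
    by (simp add: replicate_app_Cons_same)
  have "attach (Suc m, Cup True) (?p @ [True] @ z) = Some (?p @ [True, True, False] @ z)"
    and "attach (m, Cross s) (?p @ [True, True, False] @ z) = Some (?p @ [True, True, False] @ z)"
    and "attach (Suc m, Cap) (?p @ [True, True, False] @ z) = Some (?p @ [True] @ z)"
    and "attach (m, Cup True) (?p @ [True] @ z) = Some (?p @ [True, False, True] @ z)"
    and "attach (Suc m, Cross t) (?p @ [True, False, True] @ z) = Some (?p @ [True, True, False] @ z)"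
    and "attach (Suc m, Cap) (?p @ [True, False, True] @ z) = Some (?p @ [True] @ z)"
    for t
    using attach_Cup_at[of "?p @ [True]" "Suc m" True z]
      attach_Cross_at[of ?p m s True True "False # z"]
      attach_Cap_at[of "?p @ [True]" "Suc m" True False z]
      attach_Cup_at[of ?p m True "True # z"]
      attach_Cross_at[of "?p @ [True]" "Suc m" t False True z]
      attach_Cap_at[of "?p @ [True]" "Suc m" False True z]
    by (simp_all del: attach.simps)
  then have links: "link_diagram (u @ [(Suc m, Cup True), (m, Cross s), (Suc m, Cap)] @ v)"
    "link_diagram (u @ [(m, Cup True), (Suc m, Cross (\<not> s)), (Suc m, Cap)] @ v)"
    "link_diagram (u @ [(m, Cup True), (Suc m, Cap)] @ v)"
    by (intro eval; simp only: rep run.simps bind.simps)+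
  have "isotopic (u @ [(m, Cup True), (Suc m, Cross (\<not> s))] @ ([(Suc m, Cap)] @ v))
                 (u @ [(Suc m, Cup True), (m, Cross (\<not> \<not> s))] @ ([(Suc m, Cap)] @ v))"
    by (rule isotopic.move[OF move.slide_cup]) (use links in simp_all)
  moreover have "isotopic ((u @ [(m, Cup True)]) @ [(Suc m, Cross (\<not> s)), (Suc m, Cap)] @ v)
      ((u @ [(m, Cup True)]) @ [(Suc m, Cap)] @ v)"
    by (rule isotopic.move[OF move.reidemeister1_cap]) (use links in simp_all)
  moreover have "isotopic (u @ [(m, Cup True), (Suc m, Cap)] @ v) (u @ [] @ v)"
    by (rule isotopic.move[OF move.zigzag_right]) (use links link in simp_all)
  ultimately show ?thesis
    by (auto intro: isotopic.trans isotopic.sym)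
qed

text \<open>The innermost cup is moved up past \<open>x\<close> and the innermost cap down past
  \<open>y\<close>; the crossing between them is then a kink.\<close>

lemma isotopic_markov:
  assumes x: "is_braid (Suc m) x" and y: "is_braid (Suc m) y"
  shows "isotopic (closure (Suc (Suc m)) (x @ [(m, Cross s)] @ y)) (closure (Suc m) (x @ y))"
proof -
  let ?n = "Suc m" and ?F = "replicate (Suc m) False"
  have run_x: "run (cups ?n @ x) [] = Some (replicate ?n True @ ?F)"
    using x by (simp only: run_append run_cups run_braid bind.simps)
  have cup: "attach (?n, Cup True) (replicate ?n True @ ?F) = Some (replicate ?n True @ [True, False] @ ?F)"
    by simp
  have cap: "attach (?n, Cap) (replicate ?n True @ [True, False] @ ?F) = Some (replicate ?n True @ ?F)"
    by (simp add: nth_append del: replicate_Suc)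
  have cross: "attach (m, Cross s) (replicate ?n True @ [True, False] @ ?F) =
      Some (replicate ?n True @ [True, False] @ ?F)"
    using attach_cross_up[of m "Suc ?n" s "False # ?F"]
    by (simp add: replicate_app_Cons_same del: attach.simps)
  note runs = run_append run_cups run_x run_braid[OF x] run_braid[OF y] run_caps cup cap cross
  have "isotopic (cups ?n @ x @ [(?n, Cup True)] @ ([(m, Cross s)] @ y @ [(?n, Cap)] @ caps ?n))
      (cups ?n @ [(?n, Cup True)] @ x @ ([(m, Cross s)] @ y @ [(?n, Cap)] @ caps ?n))"
  proof (rule isotopic_slide[OF _ x run_cups cup])
    show "move [(j, Cross t), (?n, Cup True)] [(?n, Cup True), (j, Cross t)]" if "Suc j < ?n" for j t
      using move.height[of j "Cross t" ?n "Cup True"] that by simp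
    show "link_diagram (cups ?n @ x @ [(?n, Cup True)] @ [(m, Cross s)] @ y @ [(?n, Cap)] @ caps ?n)"
      by (simp add: link_diagram_def runs del: attach.simps replicate_Suc append_Cons)
  qed
  moreover have
    "isotopic ((cups ?n @ x @ [(?n, Cup True), (m, Cross s)]) @ y @ [(?n, Cap)] @ caps ?n)
       ((cups ?n @ x @ [(?n, Cup True), (m, Cross s)]) @ [(?n, Cap)] @ y @ caps ?n)"
  proof (rule isotopic_slide[OF _ y _ cap])
    show "move [(j, Cross t), (?n, Cap)] [(?n, Cap), (j, Cross t)]" if "Suc j < ?n" for j t
      using move.height[of j "Cross t" ?n "Cap"] that by simp
    show "run (cups ?n @ x @ [(?n, Cup True), (m, Cross s)]) [] =
        Some (replicate ?n True @ [True, False] @ ?F)"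
      by (simp add: runs del: attach.simps replicate_Suc append_Cons)
    show "link_diagram ((cups ?n @ x @ [(?n, Cup True), (m, Cross s)]) @ y @ [(?n, Cap)] @ caps ?n)"
      by (simp add: link_diagram_def runs del: attach.simps replicate_Suc append_Cons)
  qed
  moreover have "isotopic ((cups ?n @ x) @ [(?n, Cup True), (m, Cross s), (?n, Cap)] @ (y @ caps ?n))
      ((cups ?n @ x) @ (y @ caps ?n))"
    by (rule isotopic_kink[OF run_x])
       (use link_diagram_closure[of ?n "x @ y"] x y in \<open>simp add: closure_def\<close>)
  ultimately have "isotopic
      (cups ?n @ [(?n, Cup True)] @ x @ [(m, Cross s)] @ y @ [(?n, Cap)] @ caps ?n)
      (cups ?n @ x @ y @ caps ?n)"
    by simp (blast intro: isotopic.trans isotopic.sym)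
  then show ?thesis
    by (simp add: closure_def cups_Suc[of ?n] caps_Suc[of ?n])
qed

section \<open>The unreduced invariant of the unknot\<close>

text \<open>The framed value of the unknot, which is also the factor contributed by a split
  circle.\<close>

definition circle_value :: laurent where
  "circle_value = (va - inverse va) / (vq - inverse vq)"

lemma vq_minus_inverse_nonzero: "vq - inverse vq \<noteq> 0"
proof
  assume "vq - inverse vq = 0"
  then have "vq * vq = vq * inverse vq"
    by simp
  then have "vq ^ 2 = 1"
    unfolding power2_eq_square by simp
  then show False
    by (simp add: vq_power_eq_1_iff)
qed

lemma framed_closure:
  "is_braid n D \<Longrightarrow> framed P (closure n D) = va powi braid_writhe D * circle_value * P (closure n D)"
  by (simp add: framed_def writhe_closure circle_value_def)

lemma homflypt_isotopic: "homflypt P \<Longrightarrow> isotopic D E \<Longrightarrow> P D = P E"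
  by (simp add: homflypt_def)

text \<open>The strands at a crossing of a closed braid are parallel, so smoothing just deletes the
  crossing.\<close>

lemma homflypt_skein_closure:
  assumes P: "homflypt P" and braid: "is_braid n x" "is_braid n y" "Suc j < n"
  shows "va * P (closure n (x @ [(j, Cross True)] @ y)) -
           inverse va * P (closure n (x @ [(j, Cross False)] @ y)) =
         (vq - inverse vq) * P (closure n (x @ y))"
proof -
  let ?st = "replicate n True @ replicate n False"
  have run: "run (cups n @ x) [] = Some ?st"
    using braid by (simp add: run_append run_cups run_braid)
  have link: "link_diagram ((cups n @ x) @ [(j, Cross True)] @ (y @ caps n))"
    using link_diagram_closure[of n "x @ [(j, Cross True)] @ y"] braid by (simp add: closure_def)
  have "?st ! j = ?st ! Suc j"
    using braid by (simp add: nth_append)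
  moreover from this have "smoothing ?st j = []"
    by (simp add: smoothing_def)
  moreover have "let parallel = (?st ! j = ?st ! Suc j) in
      va * P ((cups n @ x) @ [(j, Cross parallel)] @ (y @ caps n)) -
        inverse va * P ((cups n @ x) @ [(j, Cross (\<not> parallel))] @ (y @ caps n)) =
      (vq - inverse vq) * P ((cups n @ x) @ smoothing ?st j @ (y @ caps n))"
    using P run link unfolding homflypt_def by blast
  ultimately show ?thesis
    by (simp add: closure_def)
qed

text \<open>The two crossings change the writhe by 1 and -1, and the power of \<open>va\<close> in
  \<open>framed\<close> absorbs the coefficients \<open>va\<close> and
  \<open>inverse va\<close>.\<close>

lemma framed_skein:
  assumes "homflypt P" "is_braid n x" "is_braid n y" "Suc j < n"
  shows "framed P (closure n (x @ [(j, Cross True)] @ y)) -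
           framed P (closure n (x @ [(j, Cross False)] @ y)) =
         (vq - inverse vq) * framed P (closure n (x @ y))"
proof -
  have "va powi (braid_writhe x + braid_writhe y) * circle_value *
      (va * P (closure n (x @ [(j, Cross True)] @ y)) -
        inverse va * P (closure n (x @ [(j, Cross False)] @ y))) =
    va powi (braid_writhe x + braid_writhe y) * circle_value *
      ((vq - inverse vq) * P (closure n (x @ y)))"
    using homflypt_skein_closure[OF assms] by simp
  moreover have "va powi (braid_writhe x + (1 + braid_writhe y)) =
      va powi (braid_writhe x + braid_writhe y) * va"
    "va powi (braid_writhe x + (braid_writhe y - 1)) =
      va powi (braid_writhe x + braid_writhe y) * inverse va"
    by (simp_all add: power_int_add power_int_diff field_simps)
  ultimately show ?thesis
    using assms(2-) by (simp add: framed_closure algebra_simps)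
qed

section \<open>The Hecke functional given by braid closures\<close>

definition positive_braid :: "nat list \<Rightarrow> diagram" where
  "positive_braid w = map (\<lambda>j. (j, Cross True)) w"

lemma positive_braid_append: "positive_braid (x @ y) = positive_braid x @ positive_braid y"
  by (simp add: positive_braid_def)

lemma braid_writhe_positive: "braid_writhe (positive_braid w) = int (length w)"
  by (induction w) (simp_all add: positive_braid_def)

lemma is_braid_positive: "is_braid n (positive_braid w) \<longleftrightarrow> (\<forall>j\<in>set w. Suc j < n)"
  by (auto simp: is_braid_def positive_braid_def)

text \<open>Up to normalisation, the Ocneanu trace of the Hecke algebra on positive words.\<close>

definition closure_value :: "(diagram \<Rightarrow> laurent) \<Rightarrow> nat \<Rightarrow> nat list \<Rightarrow> laurent" where
  "closure_value P n w = framed P (closure n (positive_braid w))"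

lemma closure_value_eq:
  "\<forall>j\<in>set w. Suc j < n \<Longrightarrow>
     closure_value P n w = va ^ length w * circle_value * P (closure n (positive_braid w))"
  by (simp add: closure_value_def framed_closure is_braid_positive braid_writhe_positive)

text \<open>Far commutation and the braid relation are isotopies that keep the word length, hence
  the writhe. The quadratic relation is the skein relation at the second of two equal crossings,
  whose negative version cancels the first.\<close>

lemma hecke_functional_closure:
  assumes P: "homflypt P"
  shows "hecke_functional (closure_value P (Suc N)) N vq"
proof
  fix x y :: "nat list" and i
  assume x: "x \<in> lists {..<N}" and y: "y \<in> lists {..<N}"
  have xy: "is_braid (Suc N) (positive_braid x)" "is_braid (Suc N) (positive_braid y)"
    using x y by (auto simp: is_braid_positive)
  have moved: "closure_value P (Suc N) (x @ a @ y) = closure_value P (Suc N) (x @ b @ y)"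
    if "move (positive_braid a) (positive_braid b)" "length a = length b"
      "a \<in> lists {..<N}" "b \<in> lists {..<N}" for a b
  proof -
    have ab: "is_braid (Suc N) (positive_braid a)" "is_braid (Suc N) (positive_braid b)"
      using that by (auto simp: is_braid_positive)
    have "isotopic (closure (Suc N) (positive_braid (x @ a @ y)))
        (closure (Suc N) (positive_braid (x @ b @ y)))"
      unfolding positive_braid_append using isotopic_closure[OF that(1)] xy ab by simp
    then have "P (closure (Suc N) (positive_braid (x @ a @ y))) =
        P (closure (Suc N) (positive_braid (x @ b @ y)))"
      by (rule homflypt_isotopic[OF P])
    moreover have "\<forall>j\<in>set (x @ a @ y). Suc j < Suc N" "\<forall>j\<in>set (x @ b @ y). Suc j < Suc N"
      using x y \<open>a \<in> lists {..<N}\<close> \<open>b \<in> lists {..<N}\<close> by auto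
    ultimately show ?thesis
      using \<open>length a = length b\<close> by (simp add: closure_value_eq)
  qed
  show "closure_value P (Suc N) (x @ [i, j] @ y) = closure_value P (Suc N) (x @ [j, i] @ y)"
    if "i < N" "j < N" "i + 2 \<le> j" for j
    by (rule moved) (use that move.height[of i "Cross True" j "Cross True"] in \<open>auto simp: positive_braid_def\<close>)
  show "closure_value P (Suc N) (x @ [i, Suc i, i] @ y) =
      closure_value P (Suc N) (x @ [Suc i, i, Suc i] @ y)" if "Suc i < N"
    by (rule moved) (use that move.reidemeister3[of i True] in \<open>auto simp: positive_braid_def\<close>)
  show "closure_value P (Suc N) (x @ [i, i] @ y) =
      (vq - inverse vq) * closure_value P (Suc N) (x @ [i] @ y) + closure_value P (Suc N) (x @ y)"
    if "i < N"
  proof -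
    let ?x = "positive_braid x" and ?y = "positive_braid y"
    let ?xi = "?x @ [(i, Cross True)]"
    have xi: "is_braid (Suc N) ?xi"
      using xy that by simp
    have "isotopic (closure (Suc N) (?x @ [(i, Cross True), (i, Cross (\<not> True))] @ ?y))
        (closure (Suc N) (?x @ [] @ ?y))"
      by (rule isotopic_closure[OF move.reidemeister2]) (use xy that in auto)
    then have "P (closure (Suc N) (?xi @ [(i, Cross False)] @ ?y)) = P (closure (Suc N) (?x @ ?y))"
      using homflypt_isotopic[OF P] by simp
    then have "framed P (closure (Suc N) (?xi @ [(i, Cross False)] @ ?y)) =
        framed P (closure (Suc N) (?x @ ?y))"
      using xy that by (simp add: framed_closure)
    then show ?thesis
      using framed_skein[OF P xi xy(2), of i] that
      by (simp add: closure_value_def positive_braid_def diff_eq_eq)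
  qed
qed simp

text \<open>A crossing of either sign between the last two strands can be removed by the Markov
  move, so the skein relation there compares the closures with and without the extra strand.\<close>

lemma closure_value_circle:
  assumes P: "homflypt P" and w: "\<And>j. j \<in> set w \<Longrightarrow> j < m"
  shows "closure_value P (Suc (Suc m)) w = circle_value * closure_value P (Suc m) w"
proof -
  let ?w = "positive_braid w"
  have braid: "is_braid (Suc m) ?w" "is_braid (Suc (Suc m)) ?w"
    using w by (auto simp: is_braid_positive intro: less_SucI)
  have kink: "P (closure (Suc (Suc m)) (?w @ [(m, Cross s)] @ [])) = P (closure (Suc m) (?w @ []))" for s
    by (rule homflypt_isotopic[OF P isotopic_markov]) (use braid in auto)
  have "(va - inverse va) * P (closure (Suc m) ?w) =
      (vq - inverse vq) * P (closure (Suc (Suc m)) ?w)"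
    using homflypt_skein_closure[OF P braid(2) _ , of "[]" m] kink[of True] kink[of False]
    by (simp add: left_diff_distrib)
  then have "P (closure (Suc (Suc m)) ?w) = circle_value * P (closure (Suc m) ?w)"
    using vq_minus_inverse_nonzero by (simp add: circle_value_def field_simps)
  then show ?thesis
    using w by (simp add: closure_value_eq less_SucI)
qed

text \<open>The Markov move preserves \<open>P\<close>; the factor \<open>va\<close> is the lost
  crossing's share of the writhe.\<close>

lemma closure_value_kink:
  assumes P: "homflypt P" and "\<And>j. j \<in> set x \<union> set y \<Longrightarrow> j < m"
  shows "closure_value P (Suc (Suc m)) (x @ m # y) = va * closure_value P (Suc m) (x @ y)"
proof -
  have "P (closure (Suc (Suc m)) (positive_braid x @ [(m, Cross True)] @ positive_braid y)) =
      P (closure (Suc m) (positive_braid x @ positive_braid y))"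
    using assms(2) by (intro homflypt_isotopic[OF P] isotopic_markov) (auto simp: is_braid_positive)
  then have "P (closure (Suc (Suc m)) (positive_braid (x @ m # y))) =
      P (closure (Suc m) (positive_braid (x @ y)))"
    by (simp add: positive_braid_def)
  moreover have "\<forall>j\<in>set (x @ m # y). Suc j < Suc (Suc m)"
    using assms(2) by (auto intro: less_SucI)
  moreover have "\<forall>j\<in>set (x @ y). Suc j < Suc m"
    using assms(2) by auto
  ultimately show ?thesis
    by (simp add: closure_value_eq)
qed

section \<open>The trace of the symmetrizer\<close>

definition symmetrizer_closure :: "(diagram \<Rightarrow> laurent) \<Rightarrow> nat \<Rightarrow> laurent" where
  "symmetrizer_closure P n = (\<Sum>w\<leftarrow>perm_braids n. vq ^ length w * closure_value P n w)"

text \<open>The summand \<open>k\<close> comes from the representative with \<open>k + 1\<close>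
  letters: its length gives \<open>vq ^ (k + 1)\<close>, its first letter \<open>m\<close> is a kink
  giving \<open>va\<close>, and absorbing the other \<open>k\<close> letters gives
  \<open>vq ^ k\<close>.\<close>

lemma symmetrizer_closure_Suc:
  assumes P: "homflypt P"
  shows "symmetrizer_closure P (Suc (Suc m)) =
    (circle_value + (\<Sum>k\<le>m. va * vq ^ (2 * k + 1))) * symmetrizer_closure P (Suc m)"
proof -
  interpret hecke_functional "closure_value P (Suc m)" m vq
    by (rule hecke_functional_closure[OF P])
  have letters: "j < m" if "w \<in> set (perm_braids (Suc m))" "j \<in> set w" for w j
    using perm_braids_letters[OF that] by simp
  define f where "f = (\<lambda>w. vq ^ length w * closure_value P (Suc (Suc m)) w)"
  have circle: "(\<Sum>w\<leftarrow>perm_braids (Suc m). f w) = circle_value * symmetrizer_closure P (Suc m)"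
  proof -
    have "(\<Sum>w\<leftarrow>perm_braids (Suc m). f w) =
        (\<Sum>w\<leftarrow>perm_braids (Suc m). circle_value * (vq ^ length w * closure_value P (Suc m) w))"
    proof (rule sum_list_map_cong)
      fix w assume "w \<in> set (perm_braids (Suc m))"
      from closure_value_circle[OF P letters[OF this]]
      show "f w = circle_value * (vq ^ length w * closure_value P (Suc m) w)"
        by (simp add: f_def)
    qed
    then show ?thesis
      by (simp only: symmetrizer_closure_def sum_list_const_mult)
  qed
  have kink: "(\<Sum>w\<leftarrow>perm_braids (Suc m). f (w @ rev [Suc m - Suc k..<Suc m])) =
      va * vq ^ (2 * k + 1) * symmetrizer_closure P (Suc m)" if k: "k \<le> m" for k
  proof -
    define v where "v = rev [m - k..<m]"
    have v: "rev [Suc m - Suc k..<Suc m] = m # v" "length v = k" "\<And>j. j \<in> set v \<Longrightarrow> j < m"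
      using k by (auto simp: v_def)
    have "f (w @ m # v) = va * vq ^ (k + 1) * (vq ^ length w * closure_value P (Suc m) (w @ v))"
      if "w \<in> set (perm_braids (Suc m))" for w
      using closure_value_kink[OF P, of w v m] letters[OF that] v(2,3)
      by (auto simp: f_def power_add)
    then have "(\<Sum>w\<leftarrow>perm_braids (Suc m). f (w @ m # v)) = (\<Sum>w\<leftarrow>perm_braids (Suc m).
        va * vq ^ (k + 1) * (vq ^ length w * closure_value P (Suc m) (w @ v)))"
      by (rule sum_list_map_cong)
    also have "\<dots> = va * vq ^ (k + 1) * sym_sum (Suc m) v"
      by (simp only: sym_sum_def sum_list_const_mult)
    also have "sym_sum (Suc m) v = vq ^ k * symmetrizer_closure P (Suc m)"
      using sym_sum_absorb_word[of "Suc m" v] v(2,3) by (simp add: sym_sum_def symmetrizer_closure_def)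
    also have "va * vq ^ (k + 1) * (vq ^ k * symmetrizer_closure P (Suc m)) =
        va * (vq ^ (k + 1) * vq ^ k) * symmetrizer_closure P (Suc m)"
      by (simp only: mult.assoc)
    also have "vq ^ (k + 1) * vq ^ k = vq ^ (2 * k + 1)"
      by (simp add: mult_2 flip: power_add)
    finally show ?thesis
      unfolding v(1) .
  qed
  have "symmetrizer_closure P (Suc (Suc m)) =
      (\<Sum>k\<le>Suc m. \<Sum>w\<leftarrow>perm_braids (Suc m). f (w @ rev [Suc m - k..<Suc m]))"
    unfolding symmetrizer_closure_def f_def by (rule sum_perm_braids_Suc)
  also have "\<dots> = (\<Sum>w\<leftarrow>perm_braids (Suc m). f w) +
      (\<Sum>k\<le>m. \<Sum>w\<leftarrow>perm_braids (Suc m). f (w @ rev [Suc m - Suc k..<Suc m]))"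
    by (subst sum.atMost_Suc_shift) simp
  also have "\<dots> = circle_value * symmetrizer_closure P (Suc m) +
      (\<Sum>k\<le>m. va * vq ^ (2 * k + 1) * symmetrizer_closure P (Suc m))"
    unfolding circle by (intro arg_cong2[of _ _ _ _ "(+)"] HOL.refl sum.cong[OF HOL.refl] kink) simp
  finally show ?thesis
    by (simp only: distrib_right sum_distrib_right)
qed

lemma geometric_vq: "(1 - vq ^ 2) * (\<Sum>k\<le>m. vq ^ (2 * k)) = 1 - vq ^ (2 * Suc m)"
  by (simp only: power_mult sum_gp_basic)

text \<open>The strand added to \<open>n\<close> strands contributes
  \<open>vq * (1 - va ^ 2 * vq ^ (2 * n)) / (va * (1 - vq ^ 2))\<close>, a new factor of
  \<open>qpoch\<close> up to the cleared denominators. The induction starts from one strand, whose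
  closure is the unknot.\<close>

lemma symmetrizer_closure_eq:
  assumes "homflypt P" "1 \<le> n"
  shows "symmetrizer_closure P n * va ^ n * (1 - vq ^ 2) ^ n = vq ^ n * qpoch (va ^ 2) n"
  using assms(2)
proof (induction n rule: nat_induct_at_least)
  case base
  have "closure (Suc 0) (positive_braid []) = unknot"
    by (simp add: closure_def cups_def caps_def positive_braid_def unknot_def)
  then have "symmetrizer_closure P (Suc 0) = circle_value"
    using assms(1) by (simp add: symmetrizer_closure_def closure_value_eq homflypt_def)
  moreover have "circle_value * va * (1 - vq ^ 2) = vq * (1 - va ^ 2)"
    using vq_minus_inverse_nonzero
    by (simp add: circle_value_def field_simps power2_eq_square)
  ultimately show ?case
    by (simp add: qpoch_def)
next
  case (Suc n)
  then obtain m where n: "n = Suc m"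
    by (cases n) auto
  have circle: "circle_value * (va * (1 - vq ^ 2)) = vq * (1 - va ^ 2)"
    using vq_minus_inverse_nonzero
    by (simp add: circle_value_def field_simps power2_eq_square)
  have "(circle_value + (\<Sum>k\<le>m. va * vq ^ (2 * k + 1))) * (va * (1 - vq ^ 2)) =
      vq * (1 - va ^ 2) + va ^ 2 * vq * ((1 - vq ^ 2) * (\<Sum>k\<le>m. vq ^ (2 * k)))"
    unfolding distrib_right circle by (simp add: sum_distrib_left sum_distrib_right power2_eq_square mult_ac)
  also have "\<dots> = vq * (1 - va ^ 2 * vq ^ (2 * n))"
    unfolding geometric_vq n by (simp add: algebra_simps)
  finally have "(circle_value + (\<Sum>k\<le>m. va * vq ^ (2 * k + 1))) * (va * (1 - vq ^ 2)) *
      (symmetrizer_closure P n * va ^ n * (1 - vq ^ 2) ^ n) =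
      vq * (1 - va ^ 2 * vq ^ (2 * n)) * (vq ^ n * qpoch (va ^ 2) n)"
    using Suc.IH by simp
  then show ?case
    unfolding n symmetrizer_closure_Suc[OF assms(1)] by (simp add: qpoch_def mult_ac)
qed

text \<open>The sum is the Poincare polynomial of the symmetric group in \<open>vq ^ 2\<close>, a
  q-factorial: each further strand multiplies it by a geometric sum.\<close>

lemma symmetrizer_denominator:
  "(\<Sum>w\<leftarrow>perm_braids n. vq ^ (2 * length w)) * (1 - vq ^ 2) ^ n = qpoch (vq ^ 2) n"
proof (induction n)
  case (Suc n)
  have "(\<Sum>w\<leftarrow>perm_braids (Suc n). vq ^ (2 * length w)) =
      (\<Sum>k\<le>n. \<Sum>w\<leftarrow>perm_braids n. vq ^ (2 * k) * vq ^ (2 * length w))"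
    unfolding sum_perm_braids_Suc
    by (intro sum.cong) (simp_all add: power_add algebra_simps)
  also have "\<dots> = (\<Sum>k\<le>n. vq ^ (2 * k)) * (\<Sum>w\<leftarrow>perm_braids n. vq ^ (2 * length w))"
    by (simp only: sum_list_const_mult sum_distrib_right)
  finally have "(\<Sum>w\<leftarrow>perm_braids (Suc n). vq ^ (2 * length w)) * (1 - vq ^ 2) ^ Suc n =
      ((1 - vq ^ 2) * (\<Sum>k\<le>n. vq ^ (2 * k))) *
      ((\<Sum>w\<leftarrow>perm_braids n. vq ^ (2 * length w)) * (1 - vq ^ 2) ^ n)"
    by (simp only: power_Suc mult_ac)
  also have "\<dots> = (1 - vq ^ (2 * Suc n)) * qpoch (vq ^ 2) n"
    by (simp only: Suc.IH geometric_vq)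
  finally show ?case
    by (simp add: qpoch_def power_add power2_eq_square mult_ac)
qed (simp add: qpoch_def)

text \<open>The diagram has one cup and no crossings, so its cable is the closed symmetrizer and the
  framing correction is trivial.\<close>

lemma unreduced_sym_unknot_sum:
  "unreduced_sym P r unknot =
     symmetrizer_closure P r / (\<Sum>w\<leftarrow>perm_braids r. vq ^ (2 * length w))"
proof -
  have "writhe unknot = 0"
    by (simp add: writhe_def unknot_def)
  moreover have "cable r unknot =
      map (\<lambda>w. (vq ^ length w / (\<Sum>w\<leftarrow>perm_braids r. vq ^ (2 * length w)), closure r (positive_braid w)))
        (perm_braids r)"
    by (simp add: unknot_def symmetrizer_def Let_def closure_def cups_def caps_def positive_braid_def
        comp_def case_prod_beta)
  ultimately show ?thesis
    by (simp add: unreduced_sym_def symmetrizer_closure_def closure_value_def comp_def divide_inverse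
        mult_ac flip: sum_list_const_mult)
qed

lemma unreduced_sym_unknot:
  assumes "homflypt P" "1 \<le> r"
  shows "unreduced_sym P r unknot \<simeq> qpoch (va ^ 2) r / qpoch (vq ^ 2) r"
proof (rule eq_up_to_monomialI)
  define d where "d = (\<Sum>w\<leftarrow>perm_braids r. vq ^ (2 * length w))"
  have d: "d * (1 - vq ^ 2) ^ r = qpoch (vq ^ 2) r"
    unfolding d_def by (rule symmetrizer_denominator)
  then have "d \<noteq> 0" "(1 - vq ^ 2) ^ r \<noteq> 0"
    using qpoch_vq_nonzero[of r] by (metis mult_zero_left, metis mult_zero_right)
  moreover have "symmetrizer_closure P r = vq ^ r * qpoch (va ^ 2) r / (va ^ r * (1 - vq ^ 2) ^ r)"
    using symmetrizer_closure_eq[OF assms] \<open>(1 - vq ^ 2) ^ r \<noteq> 0\<close> by (simp add: field_simps)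
  ultimately show "unreduced_sym P r unknot =
      va powi (- int r) * vq powi (int r) * (qpoch (va ^ 2) r / qpoch (vq ^ 2) r)"
    unfolding unreduced_sym_unknot_sum d_def[symmetric] d[symmetric]
    by (simp add: power_int_minus field_simps)
qed

text \<open>The hypothesis \<open>twist_recursion\<close> is the known recursion granted for
  anti-parallel twist families.\<close>

theorem proposition2p5:
  fixes P :: "diagram \<Rightarrow> laurent" and r :: nat and K :: "nat \<Rightarrow> diagram" and L :: diagram
  assumes "homflypt P"
    and "1 \<le> r"
    and twist_recursion:
      "\<And>K' L'. antiparallel_twist_family K' L' \<Longrightarrow> \<exists>F. is_finite_version P r K' L' F"
    and "antiparallel_twist_family K L"
  shows "(\<lambda>i. reduced_sym P r (K i)) \<longlonglongrightarrow> finite_sym P r K L / qpoch (va ^ 2) r \<and>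
         finite_sym P r K L / qpoch (va ^ 2) r \<simeq> reduced_sym P r L / unreduced_sym P r unknot"
proof -
  define lam where "lam = (\<lambda>l. va ^ (2 * l) * vq ^ (2 * l * (l - 1)))"
  define S where "S = (\<Prod>l=1..r. 1 - lam l)"
  have S: "S \<noteq> 0"
    using one_minus_va_vq_nonzero by (simp add: S_def lam_def)
  have bracket: "(\<Prod>l=1..r. qbracket (va * vq ^ (l - 1)) l) = S / qpoch (va ^ 2) r"
    unfolding S_def lam_def by (rule prod_qbracket)
  obtain F where F: "is_finite_version P r K L F"
    using twist_recursion assms(4) by blast
  \<comment> \<open>The factor of \<open>F\<close> in the recursion is nonzero, so the recursion
    determines \<open>F\<close>, and the description in \<open>finite_sym\<close> denotes
    it.\<close>
  have "F' = F" if "is_finite_version P r K L F'" for F'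
  proof -
    have "S / qpoch (va ^ 2) r * F' = S / qpoch (va ^ 2) r * F"
      using F that unfolding is_finite_version_def bracket by metis
    then show ?thesis
      using S qpoch_va_nonzero[of r] by simp
  qed
  with F have finite_sym: "finite_sym P r K L = F"
    unfolding finite_sym_def by (rule the_equality)
  have small: "fls_order_ge 1 (lam l)" if "l \<in> {1..r}" for l
    unfolding lam_def by (rule fls_order_ge_va_vq) (use that in simp)
  have "(\<lambda>i. reduced_sym P r (K i)) \<longlonglongrightarrow>
      S / qpoch (va ^ 2) r * F / (\<Sum>i\<le>r. (- 1) ^ i * elem_sym i {1..r} lam)"
  proof (rule recursion_tendsto)
    show "(\<Sum>i\<le>r. (- 1) ^ i * elem_sym i {1..r} lam * reduced_sym P r (K (j + r - i))) =
        S / qpoch (va ^ 2) r * F" for j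
      using F unfolding is_finite_version_def bracket lam_def by blast
    show "(- 1) ^ 0 * elem_sym 0 {1..r} lam = 1"
      by (simp add: elem_sym_0)
    show "fls_order_ge 1 ((- 1) ^ i * elem_sym i {1..r} lam)" if "1 \<le> i" for i
      using fls_order_ge_elem_sym[of "{1..r}" i lam, OF _ that small]
      by (cases "even i") (auto intro: fls_order_ge_uminus)
  qed
  also have "(\<Sum>i\<le>r. (- 1) ^ i * elem_sym i {1..r} lam) = S"
    using sum_elem_sym[of "{1..r}" lam] by (simp add: S_def)
  finally have limit: "(\<lambda>i. reduced_sym P r (K i)) \<longlonglongrightarrow> F / qpoch (va ^ 2) r"
    using S by (simp add: field_simps)
  obtain s m n where unknot: "s \<in> {1, -1}"
      "unreduced_sym P r unknot = s * va powi m * vq powi n * (qpoch (va ^ 2) r / qpoch (vq ^ 2) r)"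
    using unreduced_sym_unknot[OF assms(1,2)] unfolding eq_up_to_monomial_def by blast
  \<comment> \<open>The unknot formula is turned around, so that \<open>qpoch (vq ^ 2) r\<close>
    appears in the denominator as it does in the finite version and cancels.\<close>
  have "qpoch (va ^ 2) r = qpoch (vq ^ 2) r * (qpoch (va ^ 2) r / qpoch (vq ^ 2) r)"
    using qpoch_vq_nonzero[of r] by simp
  also have "\<dots> \<simeq> qpoch (vq ^ 2) r * unreduced_sym P r unknot"
    unfolding eq_up_to_monomial_def
    by (intro bexI[of _ s] exI[of _ "- m"] exI[of _ "- n"])
       (use unknot in \<open>auto simp: power_int_minus field_simps\<close>)
  finally have "F / qpoch (va ^ 2) r \<simeq>
      qpoch (vq ^ 2) r * reduced_sym P r L / (qpoch (vq ^ 2) r * unreduced_sym P r unknot)"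
    using F unfolding is_finite_version_def by (intro eq_up_to_monomial_divide) auto
  then show ?thesis
    using limit qpoch_vq_nonzero[of r] by (simp add: finite_sym)
qed

end
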